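(* Let $D_1$ and $D_2$ be digraphs on $n_1$ and $n_2$ vertices, and $m_1$ and $m_2$ arcs, respectively. Then $$f_{A(D_1\ominus D_2)}(\lambda)=\left(\lambda-\chi_{A(D_2)}(\lambda)\right)^{m_1-n_1}\left[f_{A(D_2)}(\lambda)\right]^{m_1} f_{A(D_1)}\left(\lambda^2-\lambda\, \chi_{A(D_2)}(\lambda)\right).$$ In particular, the $A$-spectrum of $D_1\ominus D_2$ is completely determined by the $A$-spectra of $D_1$ and $D_2$, and the $A$-coronal of $D_2$.
   Context: All digraphs are nonempty and simple (no loops, no multiple arcs), but both arcs $uv$ and $vu$ may be present. The adjacency matrix $A(D)=[a_{ij}]$ of a digraph $D$ with vertices $v_1,\dots,v_n$ has $a_{ij}=1$ if $v_iv_j$ is an arc and $a_{ij}=0$ otherwise. For an $n\times n$ real matrix $M$, $f_M(\lambda)=\det(\lambda I_n-M)$ is its characteristic polynomial and its coronal is $\chi_M(\lambda)=\mathbf 1_n^T(\lambda I_n-M)^{-1}\mathbf 1_n\in\mathbb C(\lambda)$, where $\mathbf 1_n$ is the all-ones column vector. The $A$-spectrum of $D$ consists of the roots of $f_{A(D)}$, and the $A$-coronal of $D$ is $\chi_{A(D)}$. The subdivision digraph $\mathcal S(D)$ is obtained from $D$ by replacing each arc $uv$ by a directed path $u\to w\to v$ of length two through a new vertex $w$ (one new vertex per arc); $I(D)$ denotes the set of new vertices. The (symmetric) subdivision-arc corona $D_1\ominus D_2$ is obtained by taking $\mathcal S(D_1)$ and $m_1$ copies of $D_2$ (all vertex-disjoint;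 $m_1$ is the number of arcs of $D_1$), one copy $D_2^{(v)}$ for each new vertex $v\in I(D_1)$, and adding, for every $v\in I(D_1)$, both arcs $vw$ and $wv$ for all $w\in V(D_2^{(v)})$.
   Formalization: In the "in particular" clause the number of arcs m_1 of D_1 is also taken as given: without it the claim fails, e.g. two isolated vertices and a single arc on two vertices have the same A-spectrum, but their coronas with K_1 have 2 and 4 vertices. *)

theory Defs
  imports
    "Graph_Theory.Pair_Digraph"
    "Jordan_Normal_Form.Char_Poly"
    "Jordan_Normal_Form.Gauss_Jordan_Elimination"
    "HOL-Computational_Algebra.Polynomial_Factorial"
begin

text \<open>
  Finite simple digraphs are modelled by the locale \<open>pair_digraph\<close>: arcs are ordered pairs of
  distinct vertices, and \<open>(u, v)\<close> and \<open>(v, u)\<close> may both be arcs.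
\<close>

definition vertex_enum :: "'a pair_pre_digraph \<Rightarrow> 'a list \<Rightarrow> bool" where
  "vertex_enum D vs \<longleftrightarrow> distinct vs \<and> set vs = pverts D"

text \<open>The adjacency matrix depends on the chosen listing \<open>vs\<close> of the vertices.\<close>

definition adjacency_matrix :: "'a pair_pre_digraph \<Rightarrow> 'a list \<Rightarrow> real mat" where
  "adjacency_matrix D vs =
     mat (length vs) (length vs) (\<lambda>(i, j). if (vs ! i, vs ! j) \<in> parcs D then 1 else 0)"

text \<open>
  The field of rational functions over the complex numbers is \<open>complex poly fract\<close>. In it,
  \<open>ratfun_of p\<close> is the polynomial \<open>p\<close>, \<open>ratfun_const c\<close> the constant \<open>c\<close> and
  \<open>ratfun_var\<close> the indeterminate. Polynomials over the complex numbers can be evaluated at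
  rational functions (\<open>poly_at\<close>).
\<close>

abbreviation ratfun_of :: "complex poly \<Rightarrow> complex poly fract" where
  "ratfun_of p \<equiv> to_fract p"

definition ratfun_const :: "complex \<Rightarrow> complex poly fract" where
  "ratfun_const c = ratfun_of [:c:]"

definition ratfun_var :: "complex poly fract" where
  "ratfun_var = ratfun_of [:0, 1:]"

definition poly_at :: "complex poly \<Rightarrow> complex poly fract \<Rightarrow> complex poly fract" where
  "poly_at p x = poly (map_poly ratfun_const p) x"

definition complex_char_poly :: "real mat \<Rightarrow> complex poly" where
  "complex_char_poly M = char_poly (map_mat complex_of_real M)"

definition resolvent_matrix :: "real mat \<Rightarrow> complex poly fract mat" where
  "resolvent_matrix M =
     ratfun_var \<cdot>\<^sub>m 1\<^sub>m (dim_row M) - map_mat (\<lambda>a. ratfun_const (complex_of_real a)) M"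

definition coronal :: "real mat \<Rightarrow> complex poly fract" where
  "coronal M =
     (let one = vec (dim_row M) (\<lambda>_. 1)
      in one \<bullet> (the (mat_inverse (resolvent_matrix M)) *\<^sub>v one))"

text \<open>The spectrum is a multiset: roots are counted with multiplicity.\<close>

definition A_spectrum :: "'a pair_pre_digraph \<Rightarrow> 'a list \<Rightarrow> complex multiset" where
  "A_spectrum D vs = proots (complex_char_poly (adjacency_matrix D vs))"

text \<open>The new vertex on the arc \<open>a\<close> is \<open>Inr a\<close>; the old vertices are tagged by \<open>Inl\<close>.\<close>

definition subdivision_digraph ::
    "'a pair_pre_digraph \<Rightarrow> ('a + 'a \<times> 'a) pair_pre_digraph" where
  "subdivision_digraph D =
     \<lparr> pverts = Inl ` pverts D \<union> Inr ` parcs D,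
       parcs = {(Inl u, Inr (u, v)) | u v. (u, v) \<in> parcs D}
             \<union> {(Inr (u, v), Inl v) | u v. (u, v) \<in> parcs D} \<rparr>"

definition new_vertices :: "'a pair_pre_digraph \<Rightarrow> ('a + 'a \<times> 'a) set" where
  "new_vertices D = Inr ` parcs D"

text \<open>
  In the corona, \<open>Inl x\<close> is the vertex \<open>x\<close> of the subdivision digraph of \<open>D1\<close>, and
  \<open>Inr (v, w)\<close> is the vertex \<open>w\<close> in the copy of \<open>D2\<close> belonging to the new vertex \<open>v\<close>.
\<close>

definition subdivision_arc_corona ::
    "'a pair_pre_digraph \<Rightarrow> 'b pair_pre_digraph \<Rightarrow>
     (('a + 'a \<times> 'a) + ('a + 'a \<times> 'a) \<times> 'b) pair_pre_digraph" where
  "subdivision_arc_corona D1 D2 =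
     \<lparr> pverts = Inl ` pverts (subdivision_digraph D1)
              \<union> Inr ` (new_vertices D1 \<times> pverts D2),
       parcs = {(Inl x, Inl y) | x y. (x, y) \<in> parcs (subdivision_digraph D1)}
             \<union> {(Inr (v, w), Inr (v, w')) | v w w'. v \<in> new_vertices D1 \<and> (w, w') \<in> parcs D2}
             \<union> {(Inl v, Inr (v, w)) | v w. v \<in> new_vertices D1 \<and> w \<in> pverts D2}
             \<union> {(Inr (v, w), Inl v) | v w. v \<in> new_vertices D1 \<and> w \<in> pverts D2} \<rparr>"

lemma pair_digraph_corona:
  assumes "pair_digraph D1" "pair_digraph D2"
  shows "pair_digraph (subdivision_arc_corona D1 D2)"
proof -
  interpret D1: pair_digraph D1 by fact
  interpret D2: pair_digraph D2 by fact
  let ?C = "subdivision_arc_corona D1 D2"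
  note defs = subdivision_arc_corona_def subdivision_digraph_def new_vertices_def
  have sub: "parcs ?C \<subseteq> pverts ?C \<times> pverts ?C"
    unfolding defs using D1.in_arcsD1 D1.in_arcsD2 D2.in_arcsD1 D2.in_arcsD2
    by (auto simp: image_iff)
  have fin: "finite (pverts ?C)"
    unfolding defs using D1.pair_finite_verts D1.pair_finite_arcs D2.pair_finite_verts by auto
  have "finite (parcs ?C)"
    using finite_subset[OF sub] fin by blast
  moreover have "fst e \<noteq> snd e" if "e \<in> parcs ?C" for e
    using that unfolding defs by (auto dest: D1.pair_no_loops D2.pair_no_loops)
  ultimately show ?thesis
    using sub fin by unfold_locales auto
qed

text \<open>\<open>resolvent_matrix M\<close> is always invertible, so the option in \<open>coronal\<close> is never \<open>None\<close>.\<close>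

lemma mat_inverse_resolvent:
  assumes M: "M \<in> carrier_mat n n"
  shows "\<exists>B. mat_inverse (resolvent_matrix M) = Some B \<and> B \<in> carrier_mat n n \<and>
             resolvent_matrix M * B = 1\<^sub>m n \<and> B * resolvent_matrix M = 1\<^sub>m n"
proof -
  let ?R = "resolvent_matrix M" and ?C = "map_mat complex_of_real M"
  have R: "?R \<in> carrier_mat n n"
    using M by (auto simp: resolvent_matrix_def)
  interpret h: inj_comm_ring_hom "to_fract :: complex poly \<Rightarrow> complex poly fract"
    by unfold_locales auto
  have "?R = map_mat to_fract (char_poly_matrix ?C)"
  proof (rule eq_matI)
    fix i j
    assume "i < dim_row (map_mat to_fract (char_poly_matrix ?C))"
      "j < dim_col (map_mat to_fract (char_poly_matrix ?C))"
    hence ij: "i < n" "j < n" using M by (auto simp: char_poly_matrix_def)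
    have "[:- complex_of_real (M $$ (i, j)):] = - [:complex_of_real (M $$ (i, j)):]"
      by simp
    then show "?R $$ (i, j) = map_mat to_fract (char_poly_matrix ?C) $$ (i, j)"
      using M ij
      by (auto simp: resolvent_matrix_def char_poly_matrix_def ratfun_const_def ratfun_var_def
          h.hom_add[symmetric] h.hom_minus[symmetric] simp flip: h.hom_uminus)
  qed (use M in \<open>auto simp: resolvent_matrix_def char_poly_matrix_def\<close>)
  hence "det ?R = to_fract (char_poly ?C)"
    by (simp add: char_poly_def h.hom_det)
  moreover have "char_poly ?C \<noteq> 0"
    using degree_monic_char_poly[of ?C n] M by auto
  ultimately have "det ?R \<noteq> 0" by simp
  hence "?R \<in> Units (ring_mat TYPE(complex poly fract) n ())"
    using det_non_zero_imp_unit[OF R, where b = "()"] by simp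
  then obtain B where "mat_inverse ?R = Some B"
    using mat_inverse(1)[OF R, where b = "()"] by auto
  with mat_inverse(2)[OF R this] show ?thesis by blast
qed

end

theory Submission
  imports Defs
begin

text \<open>
  Write \<open>\<lambda>\<close> for the indeterminate, \<open>\<chi>\<close> for the coronal of \<open>D2\<close> and \<open>s = \<lambda> - \<chi>\<close>. List the
  vertices of the corona as old vertices, new vertices (one per arc of \<open>D1\<close>), and vertices of the
  copies of \<open>D2\<close>. Over the field of rational functions, \<open>\<lambda>I - A\<close> then is the block matrix
  with rows

  \<^item> \<open>\<lambda>I, -B, 0\<close>,
  \<^item> \<open>-C, \<lambda>I, -I \<otimes> 1\<^sup>T\<close>,
  \<^item> \<open>0, -I \<otimes> 1, I \<otimes> (\<lambda>I - A2)\<close>,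

  where \<open>B\<close> records the tail and \<open>C\<close> the head of each arc, so that \<open>BC = A1\<close>. Two Schur
  complements (\<open>ldet_Schur\<close>) evaluate its determinant. Eliminating the copies gives the factor
  \<open>det (\<lambda>I - A2)\<close> once per arc and replaces the middle diagonal block by
  \<open>(\<lambda> - 1\<^sup>T (\<lambda>I - A2)\<^sup>-\<^sup>1 1) I = s I\<close>, which is where the coronal comes from. Eliminating the new
  vertices gives \<open>s\<close> once per arc and leaves \<open>\<lambda>I - BC/s = (s\<lambda>I - A1)/s\<close>, whose determinant is
  the characteristic polynomial of \<open>A1\<close> at \<open>s\<lambda>\<close> divided by \<open>s\<close> once per vertex of \<open>D1\<close>.

  The second elimination divides by \<open>s\<close>. The same Schur complement, applied to \<open>D2\<close> with one
  extra vertex joined to all others, shows that \<open>s \<cdot> det (\<lambda>I - A2)\<close> is again a characteristic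
  polynomial, hence monic, so \<open>s \<noteq> 0\<close> (\<open>var_minus_coronal_nonzero\<close>).

  The statement on spectra follows because a monic complex polynomial is the product of the linear
  factors of its roots (\<open>char_poly_eq_if_spectrum_eq\<close>), and its degree gives the number of
  vertices that occurs in the exponent.
\<close>

section \<open>Matrices and determinants indexed by lists of labels\<close>

text \<open>
  Indexing rows and columns by lists of labels keeps the entries expressed through vertices and
  arcs; block decompositions become concatenations of lists.
\<close>

definition lmat :: "('a \<Rightarrow> 'b \<Rightarrow> 'k) \<Rightarrow> 'a list \<Rightarrow> 'b list \<Rightarrow> 'k mat" where
  "lmat f xs ys = mat (length xs) (length ys) (\<lambda>(i, j). f (xs ! i) (ys ! j))"

definition ldet :: "('a \<Rightarrow> 'a \<Rightarrow> 'k::comm_ring_1) \<Rightarrow> 'a list \<Rightarrow> 'k" where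
  "ldet f xs = det (lmat f xs xs)"

lemma lmat_carrier [simp]: "lmat f xs ys \<in> carrier_mat (length xs) (length ys)"
  by (simp add: lmat_def)

lemma lmat_cong:
  assumes "\<And>x y. x \<in> set xs \<Longrightarrow> y \<in> set ys \<Longrightarrow> f x y = g x y"
  shows "lmat f xs ys = lmat g xs ys"
  unfolding lmat_def by (rule cong_mat) (auto simp: assms)

lemma ldet_cong:
  assumes "\<And>x y. x \<in> set xs \<Longrightarrow> y \<in> set xs \<Longrightarrow> f x y = g x y"
  shows "ldet f xs = ldet g xs"
  unfolding ldet_def using lmat_cong[of xs xs f g] assms by simp

lemma ldet_map: "ldet f (map h xs) = ldet (\<lambda>x y. f (h x) (h y)) xs"
  unfolding ldet_def lmat_def by (rule arg_cong[where f = det]) (auto intro!: eq_matI)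

lemma ldet_scale: "ldet (\<lambda>x y. c * f x y) xs = c ^ length xs * ldet f xs"
proof -
  have "lmat (\<lambda>x y. c * f x y) xs xs = c \<cdot>\<^sub>m lmat f xs xs"
    by (rule eq_matI) (auto simp: lmat_def)
  then show ?thesis by (simp add: ldet_def) (simp add: lmat_def)
qed

lemma lmat_one: "distinct xs \<Longrightarrow> lmat (\<lambda>x y. if x = y then 1 else 0) xs xs = 1\<^sub>m (length xs)"
  by (rule eq_matI) (auto simp: lmat_def nth_eq_iff_index_eq)

text \<open>Distinctness makes the sum over the set of middle labels run over each position once.\<close>

lemma lmat_mult:
  fixes f :: "'a \<Rightarrow> 'b \<Rightarrow> 'k::comm_ring_1"
  assumes "distinct ys"
  shows "lmat f xs ys * lmat g ys zs = lmat (\<lambda>x z. \<Sum>y\<in>set ys. f x y * g y z) xs zs"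
proof (rule eq_matI)
  fix i j assume "i < dim_row (lmat (\<lambda>x z. \<Sum>y\<in>set ys. f x y * g y z) xs zs)"
    "j < dim_col (lmat (\<lambda>x z. \<Sum>y\<in>set ys. f x y * g y z) xs zs)"
  then have ij: "i < length xs" "j < length zs" by (auto simp: lmat_def)
  have "(\<Sum>y\<in>set ys. f (xs ! i) y * g y (zs ! j)) =
      (\<Sum>k = 0..<length ys. f (xs ! i) (ys ! k) * g (ys ! k) (zs ! j))"
    using assms by (intro sum.reindex_bij_betw[symmetric] bij_betw_nth) auto
  then show "(lmat f xs ys * lmat g ys zs) $$ (i, j) =
      lmat (\<lambda>x z. \<Sum>y\<in>set ys. f x y * g y z) xs zs $$ (i, j)"
    using ij by (simp add: lmat_def scalar_prod_def)
qed (auto simp: lmat_def)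

lemma ldet_mult:
  assumes "distinct xs"
  shows "ldet (\<lambda>x z. \<Sum>y\<in>set xs. f x y * g y z) xs = ldet f xs * ldet g xs"
  unfolding ldet_def lmat_mult[OF assms, symmetric]
  by (rule det_mult[of _ "length xs"]) auto

text \<open>
  Two listings of the same labels give matrices that are conjugate by the permutation matrix
  \<open>P\<close> comparing them. Hence any vertex listing of the corona can be replaced by one
  that is adapted to its block structure.
\<close>

lemma ldet_relist:
  fixes f :: "'a \<Rightarrow> 'a \<Rightarrow> 'k::comm_ring_1"
  assumes "distinct xs" "distinct ys" "set xs = set ys"
  shows "ldet f xs = ldet f ys"
proof -
  let ?one = "\<lambda>x y :: 'a. if x = y then 1 else 0 :: 'k"
  let ?P = "lmat ?one xs ys" and ?Q = "lmat ?one ys xs"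
  have len: "length xs = length ys"
    using assms by (metis distinct_card)
  have c: "?P \<in> carrier_mat (length ys) (length ys)" "?Q \<in> carrier_mat (length ys) (length ys)"
    "lmat f ys ys \<in> carrier_mat (length ys) (length ys)"
    by (simp_all add: lmat_def len)
  have PQ: "?P * ?Q = 1\<^sub>m (length xs)"
    unfolding lmat_mult[OF assms(2)] lmat_one[OF assms(1), symmetric]
    by (rule lmat_cong) (auto simp: assms(3) if_distrib[of "\<lambda>z. z * _"] cong: if_cong)
  have "?P * lmat f ys ys * ?Q = lmat f xs xs"
    unfolding lmat_mult[OF assms(2)]
    by (rule lmat_cong)
      (auto simp: assms(3) if_distrib[of "\<lambda>z. z * _"] if_distrib[of "\<lambda>z. _ * z"] cong: if_cong)
  then have "ldet f xs = det (?P * lmat f ys ys * ?Q)" by (simp add: ldet_def)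
  also have "\<dots> = det ?P * ldet f ys * det ?Q"
    using c by (simp add: ldet_def det_mult[of _ "length ys"] mult_carrier_mat[of _ "length ys" "length ys"])
  also have "\<dots> = det (?P * ?Q) * ldet f ys"
    using c by (simp add: det_mult[of _ "length ys"])
  finally show ?thesis by (simp add: PQ)
qed

lemma lmat_append:
  "lmat f (xs @ ys) (xs @ ys) =
     four_block_mat (lmat f xs xs) (lmat f xs ys) (lmat f ys xs) (lmat f ys ys)"
  by (rule eq_matI) (auto simp: lmat_def nth_append)

lemma lmat_zero:
  assumes "\<And>x y. x \<in> set xs \<Longrightarrow> y \<in> set ys \<Longrightarrow> f x y = 0"
  shows "lmat f xs ys = 0\<^sub>m (length xs) (length ys)"
  by (rule eq_matI) (auto simp: lmat_def assms)

lemma ldet_block_upper: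
  fixes f :: "'a \<Rightarrow> 'a \<Rightarrow> 'k::idom"
  assumes "\<And>x y. x \<in> set xs \<Longrightarrow> y \<in> set ys \<Longrightarrow> f y x = 0"
  shows "ldet f (xs @ ys) = ldet f xs * ldet f ys"
  unfolding ldet_def lmat_append
  by (rule det_four_block_mat_lower_left_zero[of _ "length xs" _ "length ys"])
    (auto intro!: lmat_zero assms)

lemma ldet_block_lower:
  fixes f :: "'a \<Rightarrow> 'a \<Rightarrow> 'k::idom"
  assumes "\<And>x y. x \<in> set xs \<Longrightarrow> y \<in> set ys \<Longrightarrow> f x y = 0"
  shows "ldet f (xs @ ys) = ldet f xs * ldet f ys"
  unfolding ldet_def lmat_append
  by (rule det_four_block_mat_upper_right_zero[of _ "length xs" _ "length ys"])
    (auto intro!: lmat_zero assms)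

lemma ldet_one: "distinct xs \<Longrightarrow> ldet (\<lambda>x y. if x = y then 1 else 0) xs = 1"
  by (simp add: ldet_def lmat_one)

lemma ldet_scalar: "distinct xs \<Longrightarrow> ldet (\<lambda>x y. if x = y then c else 0) xs = c ^ length xs"
  using ldet_scale[of c "\<lambda>x y. if x = y then 1 else 0" xs]
  by (simp add: ldet_one if_distrib cong: if_cong)

lemma ldet_singleton: "ldet f [x] = f x x"
  by (simp add: ldet_def lmat_def det_single)

text \<open>
  Schur complement. The function \<open>g\<close> stands for minus the inverse of the \<open>ys\<close>-block times the
  \<open>ys\<close>-\<open>xs\<close>-block; only this equation is required of it, so no inverse matrix has to be formed.
  Multiplying on the right by the unipotent matrix \<open>e\<close> with \<open>g\<close> in the lower left corner
  clears the lower left block.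
\<close>

lemma ldet_Schur:
  fixes f :: "'a \<Rightarrow> 'a \<Rightarrow> 'k::idom"
  assumes dist: "distinct (xs @ ys)"
    and g: "\<And>x y. x \<in> set xs \<Longrightarrow> y \<in> set ys \<Longrightarrow> (\<Sum>z\<in>set ys. f y z * g z x) = - f y x"
  shows "ldet f (xs @ ys) =
    ldet (\<lambda>x x'. f x x' + (\<Sum>z\<in>set ys. f x z * g z x')) xs * ldet f ys"
proof -
  define e where "e = (\<lambda>x y. if x = y then 1 else if x \<in> set ys \<and> y \<in> set xs then g x y else 0)"
  have dxy: "distinct xs" "distinct ys" "set xs \<inter> set ys = {}" using dist by auto
  have "ldet e (xs @ ys) = ldet e xs * ldet e ys"
    by (rule ldet_block_lower) (use dxy in \<open>auto simp: e_def\<close>)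
  also have "ldet e xs = ldet (\<lambda>x y. if x = y then 1 else 0) xs"
    by (rule ldet_cong) (use dxy in \<open>auto simp: e_def\<close>)
  also have "ldet e ys = ldet (\<lambda>x y. if x = y then 1 else 0) ys"
    by (rule ldet_cong) (use dxy in \<open>auto simp: e_def\<close>)
  finally have e1: "ldet e (xs @ ys) = 1" using dxy by (simp add: ldet_one)
  define p where "p = (\<lambda>x z. \<Sum>y\<in>set (xs @ ys). f x y * e y z)"
  have sum_xs: "(\<Sum>y\<in>set xs. f x y * e y z) = (if z \<in> set xs then f x z else 0)" for x z
  proof -
    have "(\<Sum>y\<in>set xs. f x y * e y z) = (\<Sum>y\<in>set xs. if y = z then f x y else 0)"
      by (rule sum.cong) (use dxy in \<open>auto simp: e_def\<close>)
    then show ?thesis by simp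
  qed
  have p_split: "p x z = (if z \<in> set xs then f x z else 0) + (\<Sum>y\<in>set ys. f x y * e y z)" for x z
    using dxy by (simp add: p_def sum.union_disjoint sum_xs)
  have p_xs: "p x z = f x z + (\<Sum>y\<in>set ys. f x y * g y z)" if "z \<in> set xs" for x z
  proof -
    have "(\<Sum>y\<in>set ys. f x y * e y z) = (\<Sum>y\<in>set ys. f x y * g y z)"
      by (rule sum.cong) (use dxy that in \<open>auto simp: e_def\<close>)
    then show ?thesis using that by (simp add: p_split)
  qed
  have p_ys: "p x z = f x z" if "z \<in> set ys" for x z
  proof -
    have "(\<Sum>y\<in>set ys. f x y * e y z) = (\<Sum>y\<in>set ys. if y = z then f x y else 0)"
      by (rule sum.cong) (use dxy that in \<open>auto simp: e_def\<close>)
    moreover have "z \<notin> set xs" using dxy that by auto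
    ultimately show ?thesis using that by (simp add: p_split)
  qed
  have "ldet f (xs @ ys) = ldet p (xs @ ys)"
    unfolding p_def ldet_mult[OF dist] by (simp add: e1)
  also have "\<dots> = ldet p xs * ldet p ys"
    by (rule ldet_block_upper) (auto simp: p_xs g)
  also have "ldet p ys = ldet f ys" by (rule ldet_cong) (simp add: p_ys)
  also have "ldet p xs = ldet (\<lambda>x x'. f x x' + (\<Sum>z\<in>set ys. f x z * g z x')) xs"
    by (rule ldet_cong) (simp add: p_xs)
  finally show ?thesis .
qed

text \<open>The matrix is \<open>I \<otimes> f\<close>; each label of \<open>as\<close> splits off one diagonal block.\<close>

lemma ldet_copies:
  fixes f :: "'a \<Rightarrow> 'a \<Rightarrow> 'k::idom"
  assumes "distinct as"
  shows "ldet (\<lambda>(a, w) (b, w'). if a = b then f w w' else 0) (List.product as ws) =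
    ldet f ws ^ length as"
  using assms
proof (induction as)
  case Nil
  then show ?case by (simp add: ldet_def lmat_def)
next
  case (Cons a as)
  then show ?case
    by (simp, subst ldet_block_upper) (auto simp: ldet_map)
qed

section \<open>Characteristic polynomials evaluated at rational functions\<close>

definition pencil :: "'k::comm_ring_1 \<Rightarrow> ('a \<Rightarrow> 'a \<Rightarrow> 'k) \<Rightarrow> 'a \<Rightarrow> 'a \<Rightarrow> 'k" where
  "pencil x a u v = (if u = v then x else 0) - a u v"

definition adj :: "'a pair_pre_digraph \<Rightarrow> 'a \<Rightarrow> 'a \<Rightarrow> 'k::comm_ring_1" where
  "adj D u v = (if (u, v) \<in> parcs D then 1 else 0)"

lemma adjacency_matrix_lmat: "adjacency_matrix D vs = lmat (adj D) vs vs"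
  by (simp add: adjacency_matrix_def lmat_def adj_def)

lemma ratfun_const_hom: "inj_comm_ring_hom ratfun_const"
proof unfold_locales
  show "ratfun_const 1 = 1" by (simp add: ratfun_const_def flip: one_pCons)
  show "ratfun_const (x + y) = ratfun_const x + ratfun_const y" for x y
    unfolding ratfun_const_def to_fract_add[symmetric] by simp
  show "ratfun_const (x * y) = ratfun_const x * ratfun_const y" for x y
    unfolding ratfun_const_def to_fract_mult[symmetric] by simp
qed (simp_all add: ratfun_const_def)

interpretation ratfun_const: inj_comm_ring_hom ratfun_const
  by (rule ratfun_const_hom)

lemma poly_at_ratfun_var: "poly_at p ratfun_var = ratfun_of p"
proof (induction p)
  case 0
  then show ?case by (simp add: poly_at_def)
next
  case (pCons a p)
  have "poly_at (pCons a p) ratfun_var = ratfun_of [:a:] + ratfun_of [:0, 1:] * ratfun_of p"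
    using pCons by (simp add: poly_at_def map_poly_pCons ratfun_const_def ratfun_var_def)
  also have "\<dots> = ratfun_of (pCons a p)"
    by (simp flip: to_fract_add to_fract_mult)
  finally show ?case .
qed

text \<open>
  Adjacency entries are 0 and 1, so they are unchanged by the embedding of constants into
  rational functions, and evaluation at \<open>x\<close> commutes with the determinant.
\<close>

lemma poly_at_char_poly:
  assumes "distinct vs"
  shows "poly_at (complex_char_poly (adjacency_matrix D vs)) x = ldet (pencil x (adj D)) vs"
proof -
  let ?A = "lmat (adj D) vs vs :: complex poly fract mat"
  let ?C = "map_mat complex_of_real (adjacency_matrix D vs)"
  have C: "?C \<in> carrier_mat (length vs) (length vs)" by (simp add: adjacency_matrix_def)
  have A: "map_mat ratfun_const ?C = ?A"
    by (rule eq_matI) (auto simp: adjacency_matrix_lmat lmat_def adj_def)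
  have "poly_at (complex_char_poly (adjacency_matrix D vs)) x = poly (char_poly ?A) x"
    using ratfun_const.char_poly_hom[OF C] by (simp add: poly_at_def complex_char_poly_def A)
  also have "\<dots> = det (- char_matrix ?A x)"
    by (rule char_poly_matrix[of _ "length vs"]) simp
  also have "- char_matrix ?A x = lmat (pencil x (adj D)) vs vs"
    using assms
    by (intro eq_matI) (auto simp: char_matrix_def lmat_def pencil_def nth_eq_iff_index_eq)
  finally show ?thesis by (simp add: ldet_def)
qed

lemma char_poly_ldet:
  assumes "distinct vs"
  shows "ratfun_of (complex_char_poly (adjacency_matrix D vs)) = ldet (pencil ratfun_var (adj D)) vs"
  using poly_at_char_poly[OF assms, of D ratfun_var] by (simp add: poly_at_ratfun_var)

lemma monic_complex_char_poly:
  "lead_coeff (complex_char_poly (adjacency_matrix D vs)) = 1"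
  using degree_monic_char_poly[of "map_mat complex_of_real (adjacency_matrix D vs)" "length vs"]
  by (simp add: complex_char_poly_def adjacency_matrix_def)

lemma degree_complex_char_poly:
  "degree (complex_char_poly (adjacency_matrix D vs)) = length vs"
  using degree_monic_char_poly[of "map_mat complex_of_real (adjacency_matrix D vs)" "length vs"]
  by (simp add: complex_char_poly_def adjacency_matrix_def)

text \<open>A characteristic polynomial is monic and splits over the complex numbers.\<close>

lemma char_poly_eq_if_spectrum_eq:
  assumes "A_spectrum D vs = A_spectrum E us"
  shows "complex_char_poly (adjacency_matrix D vs) = complex_char_poly (adjacency_matrix E us)"
proof -
  let ?p = "complex_char_poly (adjacency_matrix D vs)"
  let ?q = "complex_char_poly (adjacency_matrix E us)"
  have "?p = (\<Prod>x\<in>#proots ?p. [:- x, 1:])"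
    using complex_poly_decompose_multiset[of ?p] unfolding monic_complex_char_poly by simp
  also have "proots ?p = proots ?q" using assms by (simp add: A_spectrum_def)
  also have "(\<Prod>x\<in>#proots ?q. [:- x, 1:]) = ?q"
    using complex_poly_decompose_multiset[of ?q] unfolding monic_complex_char_poly by simp
  finally show ?thesis .
qed

section \<open>The coronal as a sum over a resolvent vector\<close>

text \<open>
  The vector \<open>r = (\<lambda>I - A)\<^sup>-\<^sup>1 1\<close>, indexed by vertices. It solves the linear system needed for
  eliminating a copy of \<open>D\<close> with \<open>ldet_Schur\<close>.
\<close>

lemma coronal_vector:
  fixes D :: "'a pair_pre_digraph"
  assumes "distinct vs"
  obtains r where "\<And>w. w \<in> set vs \<Longrightarrow> (\<Sum>w'\<in>set vs. pencil ratfun_var (adj D) w w' * r w') = 1"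
    and "(\<Sum>w\<in>set vs. r w) = coronal (adjacency_matrix D vs)"
proof -
  let ?M = "adjacency_matrix D vs" and ?n = "length vs"
  have M: "?M \<in> carrier_mat ?n ?n" by (simp add: adjacency_matrix_def)
  obtain B where B: "mat_inverse (resolvent_matrix ?M) = Some B" "B \<in> carrier_mat ?n ?n"
    "resolvent_matrix ?M * B = 1\<^sub>m ?n"
    using mat_inverse_resolvent[OF M] by blast
  have R: "resolvent_matrix ?M = lmat (pencil ratfun_var (adj D)) vs vs"
    using assms
    by (intro eq_matI) (auto simp: resolvent_matrix_def adjacency_matrix_lmat lmat_def pencil_def
        adj_def nth_eq_iff_index_eq)
  define one :: "complex poly fract vec" where "one = vec ?n (\<lambda>_. 1)"
  define v where "v = B *\<^sub>v one"
  have v: "v \<in> carrier_vec ?n" using B(2) by (simp add: v_def one_def)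
  define r where "r w = v $ (the_inv_into {..<?n} ((!) vs) w)" for w
  have bij: "bij_betw ((!) vs) {0..<?n} (set vs)"
    using assms by (intro bij_betw_nth) auto
  have r: "r (vs ! i) = v $ i" if "i < ?n" for i
    using assms that by (auto simp: r_def intro!: arg_cong[where f = "($) v"] the_inv_into_f_f inj_on_nth)
  have Rv: "resolvent_matrix ?M *\<^sub>v v = one"
    unfolding v_def using B(2,3)
    by (subst assoc_mult_mat_vec[of _ ?n ?n _ ?n, symmetric]) (auto simp: one_def R)
  show thesis
  proof
    fix w assume "w \<in> set vs"
    then obtain i where i: "i < ?n" "w = vs ! i" by (auto simp: in_set_conv_nth)
    have "(\<Sum>w'\<in>set vs. pencil ratfun_var (adj D) w w' * r w') =
        (\<Sum>j = 0..<?n. pencil ratfun_var (adj D) w (vs ! j) * r (vs ! j))"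
      by (rule sum.reindex_bij_betw[OF bij, symmetric])
    also have "\<dots> = (resolvent_matrix ?M *\<^sub>v v) $ i"
      using i v by (simp add: R lmat_def scalar_prod_def r)
    also have "\<dots> = 1" using i by (simp add: Rv one_def)
    finally show "(\<Sum>w'\<in>set vs. pencil ratfun_var (adj D) w w' * r w') = 1" .
  next
    have "(\<Sum>w\<in>set vs. r w) = (\<Sum>j = 0..<?n. r (vs ! j))"
      by (rule sum.reindex_bij_betw[OF bij, symmetric])
    also have "\<dots> = one \<bullet> v" using v by (simp add: scalar_prod_def r one_def)
    also have "\<dots> = coronal ?M"
      using M B(1) by (simp add: coronal_def v_def one_def Let_def)
    finally show "(\<Sum>w\<in>set vs. r w) = coronal ?M" .
  qed
qed

text \<open>
  The new vertex \<open>None\<close> is joined in both directions to every element of the type, not only to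
  the vertices of \<open>D\<close>. The entries below then need no side conditions, and the arcs outside the
  vertex set do not enter the adjacency matrices, which look at listed vertices only.
\<close>

definition cone :: "'a pair_pre_digraph \<Rightarrow> 'a option pair_pre_digraph" where
  "cone D = \<lparr> pverts = insert None (Some ` pverts D),
     parcs = {(Some u, Some v) | u v. (u, v) \<in> parcs D}
           \<union> {(None, Some v) | v. True} \<union> {(Some v, None) | v. True} \<rparr>"

lemma pencil_cone [simp]:
  "pencil x (adj (cone D)) None None = x"
  "pencil x (adj (cone D)) None (Some w) = -1"
  "pencil x (adj (cone D)) (Some w) None = -1"
  "pencil x (adj (cone D)) (Some w) (Some w') = pencil x (adj D) w w'"
  by (auto simp: pencil_def adj_def cone_def)

text \<open>
  Eliminating \<open>D\<close> from the cone over \<open>D\<close> expresses the characteristic polynomial of the cone as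
  \<open>\<lambda> - \<chi>\<close> times that of \<open>D\<close>, and a characteristic polynomial is not zero.
\<close>

lemma var_minus_coronal_nonzero:
  assumes "distinct vs"
  shows "ratfun_var - coronal (adjacency_matrix D vs) \<noteq> 0"
proof
  assume zero: "ratfun_var - coronal (adjacency_matrix D vs) = 0"
  obtain r where r: "\<And>w. w \<in> set vs \<Longrightarrow> (\<Sum>w'\<in>set vs. pencil ratfun_var (adj D) w w' * r w') = 1"
    and chi: "(\<Sum>w\<in>set vs. r w) = coronal (adjacency_matrix D vs)"
    using coronal_vector[OF assms, of D] by blast
  let ?f = "pencil ratfun_var (adj (cone D))"
  have "ldet ?f ([None] @ map Some vs) =
      ldet (\<lambda>x x'. ?f x x' + (\<Sum>z\<in>set (map Some vs). ?f x z * r (the z))) [None] * ldet ?f (map Some vs)"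
    by (rule ldet_Schur) (use assms in \<open>auto simp: distinct_map sum.reindex r\<close>)
  also have "\<dots> = 0"
    using zero by (simp add: ldet_singleton sum.reindex sum_negf chi)
  finally have "ratfun_of (complex_char_poly (adjacency_matrix (cone D) (None # map Some vs))) = 0"
    using assms by (subst char_poly_ldet) (auto simp: distinct_map)
  with monic_complex_char_poly[of "cone D" "None # map Some vs"] show False by auto
qed

section \<open>The characteristic polynomial of the corona\<close>

lemma all_neq_pair:
  "(\<forall>v. a \<noteq> (u, v)) \<longleftrightarrow> fst a \<noteq> u"
  "(\<forall>u. a \<noteq> (u, v)) \<longleftrightarrow> snd a \<noteq> v"
  by (cases a; auto)+

text \<open>
  These are the nine blocks of \<open>xI - A\<close>, with the incidences of an arc expressed by \<open>fst\<close> and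
  \<open>snd\<close>. In this form a sum over all arcs collapses to the arcs with a given tail and head.
\<close>

lemma pencil_corona:
  fixes D1 :: "'a pair_pre_digraph" and D2 :: "'b pair_pre_digraph"
  defines "f \<equiv> \<lambda>x. pencil x (adj (subdivision_arc_corona D1 D2))"
  shows "f x (Inl (Inl u)) (Inl (Inl v)) = (if u = v then x else 0)"
    and "a \<in> parcs D1 \<Longrightarrow> f x (Inl (Inl u)) (Inl (Inr a)) = (if fst a = u then -1 else 0)"
    and "f x (Inl (Inl u)) (Inr (Inr b, w)) = 0"
    and "a \<in> parcs D1 \<Longrightarrow> f x (Inl (Inr a)) (Inl (Inl u)) = (if snd a = u then -1 else 0)"
    and "f x (Inl (Inr a)) (Inl (Inr b)) = (if a = b then x else 0)"
    and "a \<in> parcs D1 \<Longrightarrow> w \<in> pverts D2 \<Longrightarrow>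
      f x (Inl (Inr a)) (Inr (Inr b, w)) = (if a = b then -1 else 0)"
    and "f x (Inr (Inr b, w)) (Inl (Inl u)) = 0"
    and "a \<in> parcs D1 \<Longrightarrow> w \<in> pverts D2 \<Longrightarrow>
      f x (Inr (Inr b, w)) (Inl (Inr a)) = (if a = b then -1 else 0)"
    and "a \<in> parcs D1 \<Longrightarrow>
      f x (Inr (Inr a, w)) (Inr (Inr b, w')) = (if a = b then pencil x (adj D2) w w' else 0)"
  unfolding f_def pencil_def adj_def subdivision_arc_corona_def subdivision_digraph_def
    new_vertices_def
  by (auto simp: image_iff all_neq_pair)

text \<open>
  This formula is stated separately because the part on spectra needs it for two pairs of digraphs
  with different vertex types.
\<close>

lemma char_poly_corona:
  fixes D1 :: "'a pair_pre_digraph" and D2 :: "'b pair_pre_digraph"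
  assumes D1: "pair_digraph D1"
    and vs1: "vertex_enum D1 vs1" and vs2: "vertex_enum D2 vs2"
    and vs: "vertex_enum (subdivision_arc_corona D1 D2) vs"
  shows "ratfun_of (complex_char_poly (adjacency_matrix (subdivision_arc_corona D1 D2) vs)) =
       (ratfun_var - coronal (adjacency_matrix D2 vs2))
          powi (int (card (parcs D1)) - int (card (pverts D1)))
       * ratfun_of (complex_char_poly (adjacency_matrix D2 vs2)) ^ card (parcs D1)
       * poly_at (complex_char_poly (adjacency_matrix D1 vs1))
           (ratfun_var ^ 2 - ratfun_var * coronal (adjacency_matrix D2 vs2))"
proof -
  interpret D1: pair_digraph D1 by fact
  define s where "s = ratfun_var - coronal (adjacency_matrix D2 vs2)"
  define x where "x = ratfun_var"
  have V1: "distinct vs1" "set vs1 = pverts D1" and V2: "distinct vs2" "set vs2 = pverts D2"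
    and V: "distinct vs" "set vs = pverts (subdivision_arc_corona D1 D2)"
    using vs1 vs2 vs by (auto simp: vertex_enum_def)
  have s0: "s \<noteq> 0" unfolding s_def by (rule var_minus_coronal_nonzero[OF V2(1)])
  obtain as where as: "distinct as" "set as = parcs D1"
    using finite_distinct_list[OF D1.pair_finite_arcs] by blast
  have m1: "length as = card (parcs D1)" and n1: "length vs1 = card (pverts D1)"
    using as V1 distinct_card by fastforce+
  obtain r where r: "\<And>w. w \<in> pverts D2 \<Longrightarrow> (\<Sum>w'\<in>pverts D2. pencil x (adj D2) w w' * r w') = 1"
    and chi: "(\<Sum>w\<in>pverts D2. r w) = coronal (adjacency_matrix D2 vs2)"
    using coronal_vector[OF V2(1), of D2] unfolding V2(2) x_def by blast
  define f where "f = pencil x (adj (subdivision_arc_corona D1 D2))"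
  note f = pencil_corona[where x = x and ?D1.0 = D1 and ?D2.0 = D2, folded f_def]
  define old arc copy where "old = (\<lambda>u::'a. Inl (Inl u) :: ('a + 'a \<times> 'a) + ('a + 'a \<times> 'a) \<times> 'b)"
    and "arc = (\<lambda>a::'a \<times> 'a. Inl (Inr a) :: ('a + 'a \<times> 'a) + ('a + 'a \<times> 'a) \<times> 'b)"
    and "copy = (\<lambda>(a::'a \<times> 'a, w::'b). Inr (Inr a, w) :: ('a + 'a \<times> 'a) + ('a + 'a \<times> 'a) \<times> 'b)"
  note emb = old_def arc_def copy_def
  have inj: "inj_on old S" "inj_on arc T" "inj_on copy U" for S T U
    by (auto simp: inj_on_def emb)
  let ?os = "map old vs1" and ?as = "map arc as" and ?cs = "map copy (List.product as vs2)"
  have dist: "distinct ((?os @ ?as) @ ?cs)"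
    using V1 V2 as by (auto simp: distinct_map inj_on_def distinct_product emb)
  have labels: "set ((?os @ ?as) @ ?cs) = set vs"
    unfolding V(2) using V1 V2 as
    by (auto simp: emb subdivision_arc_corona_def subdivision_digraph_def new_vertices_def
        image_image image_Un image_iff)
  have "ratfun_of (complex_char_poly (adjacency_matrix (subdivision_arc_corona D1 D2) vs)) =
      ldet f ((?os @ ?as) @ ?cs)"
    unfolding char_poly_ldet[OF V(1)] f_def x_def
    by (rule ldet_relist[OF V(1) dist labels[symmetric]])
  also have "\<dots> = s ^ length as * ldet (\<lambda>u v. pencil x (\<lambda>u v. inverse s * adj D1 u v) u v) vs1
      * ldet (pencil x (adj D2)) vs2 ^ length as"
  proof -
    \<comment> \<open>First elimination: on the copy of the arc \<open>a\<close>, the column of \<open>a\<close> is cleared by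
      \<open>r = (\<lambda>I - A2)\<^sup>-\<^sup>1 1\<close>; all other columns of old and new vertices vanish there.\<close>
    define g :: "('a + 'a \<times> 'a) + ('a + 'a \<times> 'a) \<times> 'b \<Rightarrow>
        ('a + 'a \<times> 'a) + ('a + 'a \<times> 'a) \<times> 'b \<Rightarrow> complex poly fract"
      where "g = (\<lambda>z y. case (z, y) of
      (Inr (Inr a, w), Inl (Inr b)) \<Rightarrow> if a = b then r w else 0 | _ \<Rightarrow> 0)"
    define Cs where "Cs = set ?cs"
    define As where "As = set ?as"
    have sum_cs: "(\<Sum>z\<in>Cs. h z) = (\<Sum>a\<in>parcs D1. \<Sum>w\<in>pverts D2. h (Inr (Inr a, w)))"
      for h :: "_ \<Rightarrow> complex poly fract"
      by (simp add: Cs_def sum.reindex[OF inj(3)] as V2 sum.cartesian_product comp_def)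
        (simp add: copy_def case_prod_unfold)
    have sum_As: "(\<Sum>z\<in>As. h z) = (\<Sum>a\<in>parcs D1. h (arc a))"
      for h :: "_ \<Rightarrow> complex poly fract"
      by (simp add: As_def sum.reindex[OF inj(2)] as)
    have g_simps: "g (Inr (Inr a, w)) (Inl (Inl u)) = 0"
      "g (Inr (Inr a, w)) (Inl (Inr b)) = (if a = b then r w else 0)" for a w u b
      by (simp_all add: g_def)
    \<comment> \<open>The Schur complement differs from \<open>f\<close> only on the diagonal of the new vertices, where
      \<open>\<lambda>\<close> becomes \<open>s\<close>.\<close>
    define f' where "f' = (\<lambda>y y'. f y y' + (\<Sum>z\<in>Cs. f y z * g z y'))"
    have f': "f' (old u) (old v) = (if u = v then x else 0)"
      "a \<in> parcs D1 \<Longrightarrow> f' (old u) (arc a) = (if fst a = u then -1 else 0)"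
      "a \<in> parcs D1 \<Longrightarrow> f' (arc a) (old u) = (if snd a = u then -1 else 0)" for u v a
      by (auto simp: f'_def sum_cs f g_simps emb)
    have f'_arc: "f' (arc a) (arc b) = (if a = b then s else 0)"
      if "a \<in> parcs D1" "b \<in> parcs D1" for a b
    proof -
      have "(\<Sum>z\<in>Cs. f (arc a) z * g z (arc b)) =
          (\<Sum>c\<in>parcs D1. if c = a then (if a = b then - coronal (adjacency_matrix D2 vs2) else 0) else 0)"
        unfolding sum_cs using that
        by (intro sum.cong) (auto simp: emb f g_simps sum_negf chi)
      also have "\<dots> = (if a = b then - coronal (adjacency_matrix D2 vs2) else 0)"
        using that by simp
      finally show ?thesis
        by (auto simp: f'_def arc_def f s_def x_def)
    qed
    have elim: "(\<Sum>z\<in>Cs. f y z * g z y') = - f y y'"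
      if "y' \<in> set (?os @ ?as)" "y \<in> Cs" for y y'
    proof -
      from that(2) obtain a w where y: "y = Inr (Inr a, w)" "a \<in> parcs D1" "w \<in> pverts D2"
        by (auto simp: Cs_def copy_def as V2)
      from that(1) consider u where "y' = Inl (Inl u)" | b where "y' = Inl (Inr b)" "b \<in> parcs D1"
        by (auto simp: emb as)
      then show ?thesis
      proof cases
        case 1
        then show ?thesis by (simp add: sum_cs y f g_simps)
      next
        case 2
        have "(\<Sum>z\<in>Cs. f y z * g z y') =
            (\<Sum>c\<in>parcs D1. if c = a then (if a = b then 1 else 0) else 0)"
          unfolding sum_cs using y 2
          by (intro sum.cong) (auto simp: f g_simps r)
        then show ?thesis using y 2 by (simp add: f)
      qed
    qed
    have "ldet f ((?os @ ?as) @ ?cs) = ldet f' (?os @ ?as) * ldet f ?cs"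
      unfolding f'_def Cs_def by (rule ldet_Schur[OF dist]) (rule elim[unfolded Cs_def])
    also have "ldet f ?cs =
        ldet (\<lambda>(a, w) (b, w'). if a = b then pencil x (adj D2) w w' else 0) (List.product as vs2)"
      unfolding ldet_map by (rule ldet_cong) (auto simp: copy_def f as)
    also have "\<dots> = ldet (pencil x (adj D2)) vs2 ^ length as"
      by (rule ldet_copies[OF as(1)])
    \<comment> \<open>Second elimination: the block of the new vertices is now \<open>sI\<close>, with inverse \<open>I/s\<close>.\<close>
    also have "ldet f' (?os @ ?as) =
        ldet (\<lambda>y y'. f' y y' + (\<Sum>z\<in>As. f' y z * - (inverse s * f' z y'))) ?os * ldet f' ?as"
      unfolding As_def
    proof (rule ldet_Schur, fold As_def)
      show "distinct (?os @ ?as)" using dist distinct_append by blast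
      fix y' y assume y: "y' \<in> set ?os" "y \<in> As"
      then obtain u a where ua: "y' = old u" "y = arc a" "a \<in> parcs D1" by (auto simp: As_def as)
      have "(\<Sum>z\<in>As. f' y z * - (inverse s * f' z y')) =
          (\<Sum>b\<in>parcs D1. if b = a then - f' y y' else 0)"
        unfolding sum_As using ua s0 by (intro sum.cong) (auto simp: f'_arc)
      then show "(\<Sum>z\<in>As. f' y z * - (inverse s * f' z y')) = - f' y y'"
        using ua by simp
    qed
    also have "ldet f' ?as = s ^ length as"
      unfolding ldet_map ldet_scalar[OF as(1), symmetric]
      by (rule ldet_cong) (simp add: f'_arc as)
    also have "ldet (\<lambda>y y'. f' y y' + (\<Sum>z\<in>As. f' y z * - (inverse s * f' z y'))) ?os =
        ldet (\<lambda>u v. pencil x (\<lambda>u v. inverse s * adj D1 u v) u v) vs1"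
      unfolding ldet_map
    proof (rule ldet_cong)
      fix u v
      \<comment> \<open>\<open>BC = A1\<close>: the only arc that leaves \<open>u\<close> and enters \<open>v\<close> is \<open>(u, v)\<close>.\<close>
      have "(\<Sum>z\<in>As. f' (old u) z * - (inverse s * f' z (old v))) =
          (\<Sum>a\<in>parcs D1. if a = (u, v) then - inverse s else 0)"
        unfolding sum_As by (intro sum.cong) (auto simp: f')
      then show "f' (old u) (old v) + (\<Sum>z\<in>As. f' (old u) z * - (inverse s * f' z (old v))) =
          pencil x (\<lambda>u v. inverse s * adj D1 u v) u v"
        by (simp add: f' pencil_def adj_def)
    qed
    finally show ?thesis by (simp add: mult_ac)
  qed
  also have "ldet (\<lambda>u v. pencil x (\<lambda>u v. inverse s * adj D1 u v) u v) vs1 =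
      ldet (\<lambda>u v. inverse s * pencil (s * x) (adj D1) u v) vs1"
    using s0 by (intro ldet_cong) (simp add: pencil_def field_simps)
  also have "\<dots> = inverse s ^ length vs1 * ldet (pencil (s * x) (adj D1)) vs1"
    by (rule ldet_scale)
  also have "ldet (pencil (s * x) (adj D1)) vs1 =
      poly_at (complex_char_poly (adjacency_matrix D1 vs1))
           (ratfun_var ^ 2 - ratfun_var * coronal (adjacency_matrix D2 vs2))"
    by (simp add: poly_at_char_poly[OF V1(1)] s_def x_def algebra_simps power2_eq_square)
  also have "ldet (pencil x (adj D2)) vs2 = ratfun_of (complex_char_poly (adjacency_matrix D2 vs2))"
    by (simp add: char_poly_ldet[OF V2(1)] x_def)
  finally show ?thesis
    unfolding s_def[symmetric] m1 n1
    using s0 by (simp add: power_int_diff field_simps)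
qed

theorem theorem5p4:
  fixes D1 :: "'a pair_pre_digraph" and D2 :: "'b pair_pre_digraph"
    and n1 n2 m1 m2 :: nat
    and vs1 :: "'a list" and vs2 :: "'b list"
    and vs :: "(('a + 'a \<times> 'a) + ('a + 'a \<times> 'a) \<times> 'b) list"
  assumes "pair_digraph D1" and "pair_digraph D2"
    and "pverts D1 \<noteq> {}" and "pverts D2 \<noteq> {}"
    and "card (pverts D1) = n1" and "card (pverts D2) = n2"
    and "card (parcs D1) = m1" and "card (parcs D2) = m2"
    and "vertex_enum D1 vs1" and "vertex_enum D2 vs2" and "vertex_enum (subdivision_arc_corona D1 D2) vs"
  shows
    "ratfun_of (complex_char_poly (adjacency_matrix (subdivision_arc_corona D1 D2) vs)) =
       (ratfun_var - coronal (adjacency_matrix D2 vs2)) powi (int m1 - int n1)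
       * ratfun_of (complex_char_poly (adjacency_matrix D2 vs2)) ^ m1
       * poly_at (complex_char_poly (adjacency_matrix D1 vs1))
           (ratfun_var ^ 2 - ratfun_var * coronal (adjacency_matrix D2 vs2))
     \<and>
     (\<forall>(E1 :: 'c pair_pre_digraph) (E2 :: 'd pair_pre_digraph) us1 us2 us.
        pair_digraph E1 \<and> pair_digraph E2 \<and> pverts E1 \<noteq> {} \<and> pverts E2 \<noteq> {} \<and>
        vertex_enum E1 us1 \<and> vertex_enum E2 us2 \<and> vertex_enum (subdivision_arc_corona E1 E2) us \<and>
        card (parcs E1) = m1 \<and>
        A_spectrum E1 us1 = A_spectrum D1 vs1 \<and>
        A_spectrum E2 us2 = A_spectrum D2 vs2 \<and>
        coronal (adjacency_matrix E2 us2) = coronal (adjacency_matrix D2 vs2)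
        \<longrightarrow> A_spectrum (subdivision_arc_corona E1 E2) us = A_spectrum (subdivision_arc_corona D1 D2) vs)"
  (is "?formula \<and> ?determined")
proof
  show ?formula
    using char_poly_corona[of D1 vs1 D2 vs2 vs] assms by simp
  show ?determined
  proof (intro allI impI, elim conjE)
    fix E1 :: "'c pair_pre_digraph" and E2 :: "'d pair_pre_digraph" and us1 us2 us
    assume E: "pair_digraph E1" "vertex_enum E1 us1" "vertex_enum E2 us2"
      "vertex_enum (subdivision_arc_corona E1 E2) us" "card (parcs E1) = m1"
      and sp1: "A_spectrum E1 us1 = A_spectrum D1 vs1"
      and sp2: "A_spectrum E2 us2 = A_spectrum D2 vs2"
      and co: "coronal (adjacency_matrix E2 us2) = coronal (adjacency_matrix D2 vs2)"
    note cp = char_poly_eq_if_spectrum_eq[OF sp1] char_poly_eq_if_spectrum_eq[OF sp2]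
    \<comment> \<open>The exponent of \<open>\<lambda> - \<chi>\<close> involves the number of vertices, which the spectrum determines
      as the degree of the characteristic polynomial.\<close>
    have "length us1 = length vs1"
      using cp(1) by (metis degree_complex_char_poly)
    then have "card (pverts E1) = n1"
      using E(2) assms by (metis distinct_card vertex_enum_def)
    then have "ratfun_of (complex_char_poly (adjacency_matrix (subdivision_arc_corona E1 E2) us)) =
        ratfun_of (complex_char_poly (adjacency_matrix (subdivision_arc_corona D1 D2) vs))"
      unfolding \<open>?formula\<close> using char_poly_corona[OF E(1-4)] by (simp add: E(5) cp co)
    then show "A_spectrum (subdivision_arc_corona E1 E2) us = A_spectrum (subdivision_arc_corona D1 D2) vs"
      by (simp add: A_spectrum_def)
  qed
qed

end
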